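(* For any splitting tree $T\subseteq 2^{<\omega}$ we have $[T]\notin\mathfrak{P}_2$.
   Context: $2^{<\omega}=\bigcup_{n<\omega}2^n$ is the set of finite $0$-$1$ sequences and $2^\omega$ is the Cantor space; $[\omega]^\omega$ is the family of infinite subsets of $\omega$. A set $T\subseteq 2^{<\omega}$ is a tree if for every $\tau\in T$ and every $n\in\omega$ we have $\tau\restriction n\in T$. The body of $T$ is $[T]=\{x\in 2^\omega:(\forall n\in\omega)\ x\restriction n\in T\}$. A tree $T$ is a splitting tree if $(\forall\tau\in T)(\exists N\in\omega)(\forall n\geq N)(\forall i\in\{0,1\})(\exists\tau'\in T\cap 2^{n+1})\ (\tau\subseteq\tau'\text{ and }\tau'(n)=i)$. For $X\subseteq 2^\omega$ and $S\in[\omega]^\omega$, $X\restriction S=\{x\restriction S:x\in X\}\subseteq 2^S$. Finally, $\mathfrak{P}_2=\{X\subseteq 2^\omega:(\forall S\in[\omega]^\omega)\ X\restriction S\neq 2^S\}$.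
   Formalization: The tree T is assumed nonempty: under the literal definitions the empty set is a splitting tree whose body is empty and belongs to 𝔓₂, so the claim fails for it. *)

theory Defs
  imports Main "HOL-Library.FuncSet" "HOL-Library.Sublist"
begin

text \<open>
  Finite 0-1 sequences are boolean lists (\<open>False\<close> is 0, \<open>True\<close> is 1) and points of the Cantor
  space are functions \<open>nat \<Rightarrow> bool\<close>. The restriction of a finite sequence \<open>\<tau>\<close> to \<open>n\<close>
  is \<open>take n \<tau>\<close>, which is \<open>\<tau>\<close> itself when \<open>n\<close> exceeds the length of \<open>\<tau>\<close>.
\<close>

definition is_tree :: "bool list set \<Rightarrow> bool" where
  "is_tree T \<longleftrightarrow> (\<forall>\<tau>\<in>T. \<forall>n. take n \<tau> \<in> T)"

definition initial_segment :: "(nat \<Rightarrow> bool) \<Rightarrow> nat \<Rightarrow> bool list" where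
  "initial_segment x n = map x [0..<n]"

definition body :: "bool list set \<Rightarrow> (nat \<Rightarrow> bool) set" where
  "body T = {x. \<forall>n. initial_segment x n \<in> T}"

definition splitting_tree :: "bool list set \<Rightarrow> bool" where
  "splitting_tree T \<longleftrightarrow> is_tree T \<and>
     (\<forall>\<tau>\<in>T. \<exists>N. \<forall>n\<ge>N. \<forall>i. \<exists>\<tau>'\<in>T. length \<tau>' = n + 1 \<and> prefix \<tau> \<tau>' \<and> \<tau>' ! n = i)"

text \<open>
  Functions with domain \<open>S\<close> are represented extensionally (with value \<open>undefined\<close> off \<open>S\<close>),
  so the set of all 0-1 functions on \<open>S\<close> is the extensional function space
  \<open>S \<rightarrow>\<^sub>E UNIV\<close>.
\<close>

definition restrict_family :: "(nat \<Rightarrow> bool) set \<Rightarrow> nat set \<Rightarrow> (nat \<Rightarrow> bool) set" where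
  "restrict_family X S = (\<lambda>x. restrict x S) ` X"

definition P2 :: "(nat \<Rightarrow> bool) set set" where
  "P2 = {X. \<forall>S. infinite S \<longrightarrow> restrict_family X S \<noteq> (S \<rightarrow>\<^sub>E UNIV)}"

end

theory Submission
  imports Defs
begin

text \<open>
  Each level of the tree is finite, so the thresholds that the splitting condition provides for
  the nodes of one level have a common upper bound. Hence for every \<open>m\<close> there is a single
  coordinate \<open>n \<ge> m\<close> at which \<^emph>\<open>all\<close> nodes of length \<open>m\<close> can be extended to take either value
  (lemma \<open>common_splitting_coordinate\<close>). Iterate this: \<open>s 0\<close> is such a coordinate for the root,
  and \<open>s (Suc k)\<close> is one for the nodes of length \<open>s k + 1\<close>. Since these coordinates do not depend
  on the nodes, the infinite set \<open>S\<close> of all \<open>s k\<close> is fixed before any target \<open>y\<close> on \<open>S\<close> is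
  given. For every such \<open>y\<close> a chain of nodes can be chosen whose \<open>k\<close>-th member ends at coordinate
  \<open>s k\<close> with the value \<open>y (s k)\<close>; its union is a branch (lemma \<open>body_contains_union_of_chain\<close>)
  that agrees with \<open>y\<close> on \<open>S\<close>. So the body of the tree restricts onto all of \<open>2\<^sup>S\<close>.
\<close>

text \<open>
  There are at most \<open>2\<^sup>m\<close> nodes of length \<open>m\<close>, so the maximum of their thresholds exists. Including
  \<open>m\<close> in that maximum makes the coordinate lie beyond the level, so that iterating the lemma
  yields strictly increasing coordinates.
\<close>

lemma common_splitting_coordinate:
  assumes "splitting_tree T"
  shows "\<exists>n\<ge>m. \<forall>\<tau>\<in>T. length \<tau> = m \<longrightarrow>
           (\<forall>i. \<exists>\<tau>'\<in>T. length \<tau>' = n + 1 \<and> prefix \<tau> \<tau>' \<and> \<tau>' ! n = i)"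
proof -
  let ?L = "{\<tau> \<in> T. length \<tau> = m}"
  have "finite {\<tau> :: bool list. set \<tau> \<subseteq> UNIV \<and> length \<tau> = m}"
    by (rule finite_lists_length_eq) simp
  then have fin: "finite ?L"
    by (rule rev_finite_subset) auto
  obtain N where N: "\<And>\<tau> n i. \<tau> \<in> T \<Longrightarrow> N \<tau> \<le> n \<Longrightarrow>
      \<exists>\<tau>'\<in>T. length \<tau>' = n + 1 \<and> prefix \<tau> \<tau>' \<and> \<tau>' ! n = i"
    using assms unfolding splitting_tree_def by metis
  define n where "n = Max (insert m (N ` ?L))"
  have "m \<le> n"
    using fin unfolding n_def by simp
  moreover have "N \<tau> \<le> n" if "\<tau> \<in> T" "length \<tau> = m" for \<tau>
    using fin that unfolding n_def by (intro Max_ge) auto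
  ultimately show ?thesis
    using N by blast
qed

text \<open>
  Since \<open>t j\<close> is longer than \<open>j\<close>, the diagonal \<open>t j ! j\<close> already gives the union of the chain, and
  every initial segment of it is a truncation of a node, hence itself a node.
\<close>

lemma body_contains_union_of_chain:
  assumes tree: "is_tree T"
    and mem: "\<And>k. t k \<in> T"
    and chain: "\<And>k. prefix (t k) (t (Suc k))"
    and len: "\<And>k. k < length (t k)"
  obtains x where "x \<in> body T" and "\<And>k j. j < length (t k) \<Longrightarrow> x j = t k ! j"
proof -
  define x where "x j = t j ! j" for j
  have mono: "prefix (t k) (t l)" if "k \<le> l" for k l
    using that by (induction l rule: dec_induct) (auto intro: chain prefix_order.trans)
  have agree: "t k ! j = t l ! j" if "k \<le> l" "j < length (t k)" for j k l
    using mono[OF that(1)] that(2) by (auto simp: prefix_def nth_append)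
  have x: "x j = t k ! j" if "j < length (t k)" for j k
  proof (cases "j \<le> k")
    case True
    then show ?thesis
      unfolding x_def using len by (rule agree)
  next
    case False
    then show ?thesis
      unfolding x_def using that by (intro agree[symmetric]) auto
  qed
  have "initial_segment x n = take n (t n)" for n
    using len[of n] x[of _ n] by (intro nth_equalityI) (simp_all add: initial_segment_def)
  then have "x \<in> body T"
    using tree mem by (simp add: body_def is_tree_def)
  then show thesis
    using x that by blast
qed

theorem theorem2p6:
  fixes T :: "bool list set"
  assumes "splitting_tree T"
    and "T \<noteq> {}"
  shows "body T \<notin> P2"
proof -
  have tree: "is_tree T"
    using assms(1) by (simp add: splitting_tree_def)
  have root: "[] \<in> T"
    using assms(2) tree by (metis all_not_in_conv is_tree_def take0)
  obtain c where c_ge: "\<And>m. m \<le> c m"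
    and c: "\<And>m \<tau> i. \<tau> \<in> T \<Longrightarrow> length \<tau> = m \<Longrightarrow>
      \<exists>\<tau>'\<in>T. length \<tau>' = c m + 1 \<and> prefix \<tau> \<tau>' \<and> \<tau>' ! c m = i"
    using common_splitting_coordinate[OF assms(1)] by metis
  define s where "s = rec_nat (c 0) (\<lambda>_ n. c (n + 1))"
  have s0: "s 0 = c 0" and s_Suc: "\<And>k. s (Suc k) = c (s k + 1)"
    by (simp_all add: s_def)
  have "s k < s (Suc k)" for k
    using c_ge[of "s k + 1"] by (simp add: s_Suc)
  then have mono: "strict_mono s"
    by (simp add: strict_mono_Suc_iff)
  define S where "S = range s"
  have "infinite S"
    unfolding S_def using mono by (metis finite_imageD infinite_UNIV_nat strict_mono_imp_inj_on)
  moreover have "restrict_family (body T) S = (S \<rightarrow>\<^sub>E UNIV)"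
  proof
    show "restrict_family (body T) S \<subseteq> (S \<rightarrow>\<^sub>E UNIV)"
      by (auto simp: restrict_family_def)
  next
    show "(S \<rightarrow>\<^sub>E UNIV) \<subseteq> restrict_family (body T) S"
    proof
      fix y :: "nat \<Rightarrow> bool"
      assume y: "y \<in> S \<rightarrow>\<^sub>E UNIV"
      let ?P = "\<lambda>k \<tau>. \<tau> \<in> T \<and> length \<tau> = s k + 1 \<and> \<tau> ! s k = y (s k)"
      have "\<exists>t. \<forall>k. ?P k (t k) \<and> prefix (t k) (t (Suc k))"
      proof (rule dependent_nat_choice)
        show "\<exists>\<tau>. ?P 0 \<tau>"
          using c[OF root, of 0 "y (s 0)"] by (auto simp: s0)
        show "\<exists>\<tau>'. ?P (Suc k) \<tau>' \<and> prefix \<tau> \<tau>'" if "?P k \<tau>" for \<tau> k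
          using c[of \<tau> "s k + 1" "y (s (Suc k))"] that by (auto simp: s_Suc)
      qed
      then obtain t where t: "\<And>k. ?P k (t k)" and chain: "\<And>k. prefix (t k) (t (Suc k))"
        by blast
      have len: "k < length (t k)" for k
        using t[of k] strict_mono_imp_increasing[OF mono, of k] by linarith
      obtain x where x: "x \<in> body T" "\<And>k j. j < length (t k) \<Longrightarrow> x j = t k ! j"
        using body_contains_union_of_chain[of T t] tree t chain len by blast
      have "x (s k) = y (s k)" for k
        using x(2)[of "s k" k] t[of k] by simp
      then have "restrict x S = y"
        using y by (intro extensionalityI[of _ S]) (auto simp: S_def PiE_def)
      then show "y \<in> restrict_family (body T) S"
        using x(1) unfolding restrict_family_def by blast
    qed
  qed
  ultimately show ?thesis
    by (auto simp: P2_def)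
qed

end
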